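(* Let $G$ be a graph on $n$ vertices, and let $k_1,k_2$ be integers with $1\le k_1\le k_2\le n$. Let $L_{k_1}$ and $L_{k_2}$ be the Laplacian matrices of the token graphs $F_{k_1}(G)$ and $F_{k_2}(G)$, respectively, and let $B$ be the $(n;k_2,k_1)$-binomial matrix. Then $$B\,L_{k_1}=L_{k_2}\,B .$$
   Context: All graphs are finite and simple. For a graph $G$ with vertex set $[n]=\{1,\dots,n\}$ and $1\le k\le n$, the $k$-token graph $F_k(G)$ has as vertices the $k$-subsets of $[n]$; two vertices $A,B$ are adjacent iff $A\bigtriangleup B=\{a,b\}$ with $a\in A$, $b\in B$ and $\{a,b\}$ an edge of $G$. The Laplacian matrix of a graph is the diagonal degree matrix minus the adjacency matrix. The $(n;k_2,k_1)$-binomial matrix $B=B(n;k_2,k_1)$ is the $\binom n{k_2}\times\binom n{k_1}$ $(0,1)$-matrix with rows indexed by the $k_2$-subsets $A\subseteq[n]$ and columns indexed by the $k_1$-subsets $X\subseteq[n]$, with $B_{AX}=1$ if $X\subseteq A$ and $B_{AX}=0$ otherwise. The same orderings of the $k_1$-subsets and $k_2$-subsets are used for $B$, $L_{k_1}$, $L_{k_2}$. *)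

theory Defs
  imports
    "Graph_Theory.Pair_Digraph"
    "Jordan_Normal_Form.Matrix"
    "HOL-Library.Ramsey"
begin

text \<open>
  A simple graph is a \<^locale>\<open>pair_graph\<close>: a finite, loop-free digraph without parallel arcs
  whose arc relation is symmetric, each edge \<open>{u, v}\<close> being represented by the two arcs
  \<open>(u, v)\<close> and \<open>(v, u)\<close>.
\<close>

definition token_graph :: "nat \<Rightarrow> 'a pair_pre_digraph \<Rightarrow> 'a set pair_pre_digraph" where
  "token_graph k G =
    \<lparr> pverts = [pverts G]\<^bsup>k\<^esup>,
      parcs = {(A, B). A \<in> [pverts G]\<^bsup>k\<^esup> \<and> B \<in> [pverts G]\<^bsup>k\<^esup> \<and>
                (\<exists>a b. sym_diff A B = {a, b} \<and> a \<in> A \<and> b \<in> B \<and> (a, b) \<in> parcs G)} \<rparr>"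

lemma pair_graph_token_graph:
  assumes "pair_graph G"
  shows "pair_graph (token_graph k G)"
proof -
  interpret pair_graph G by (rule assms)
  have sym: "(b, a) \<in> parcs G" if "(a, b) \<in> parcs G" for a b
    using pair_sym_arcs that by (auto simp: symmetric_def sym_def)
  have finV: "finite ([pverts G]\<^bsup>k\<^esup>)"
    using pair_finite_verts by (rule finite_imp_finite_nsets)
  have swap: "(B, A) \<in> parcs (token_graph k G)" if "(A, B) \<in> parcs (token_graph k G)" for A B
  proof -
    from that obtain a b where "A \<in> [pverts G]\<^bsup>k\<^esup>" "B \<in> [pverts G]\<^bsup>k\<^esup>"
      and ab: "sym_diff A B = {a, b}" "a \<in> A" "b \<in> B" "(a, b) \<in> parcs G"
      by (auto simp: token_graph_def)
    moreover have "sym_diff B A = {b, a}" using ab(1) by (simp add: Un_commute insert_commute)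
    ultimately show ?thesis using sym[OF ab(4)] by (auto simp: token_graph_def)
  qed
  have sub: "parcs (token_graph k G) \<subseteq> [pverts G]\<^bsup>k\<^esup> \<times> [pverts G]\<^bsup>k\<^esup>"
    unfolding token_graph_def by auto
  have verts: "pverts (token_graph k G) = [pverts G]\<^bsup>k\<^esup>"
    by (simp add: token_graph_def)
  have loopfree: "A \<noteq> B" if "(A, B) \<in> parcs (token_graph k G)" for A B
    using that unfolding token_graph_def by force
  show ?thesis
  proof unfold_locales
    show "fst e \<in> pverts (token_graph k G)" "snd e \<in> pverts (token_graph k G)"
      "fst e \<noteq> snd e" if "e \<in> parcs (token_graph k G)" for e
      using that sub loopfree[of "fst e" "snd e"] unfolding verts by (cases e; force)+
    show "finite (pverts (token_graph k G))"
      using finV unfolding verts .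
    show "finite (parcs (token_graph k G))"
      using sub finV by (meson finite_SigmaI finite_subset)
    show "symmetric (with_proj (token_graph k G))"
      using swap by (auto simp: symmetric_def sym_def)
  qed
qed

text \<open>
  Matrices indexed by a finite set are taken with respect to an enumeration of that set as a
  list; the indices \<open>i\<close>, \<open>j\<close> below are positions in such lists.
\<close>

definition is_ordering :: "'a list \<Rightarrow> 'a set \<Rightarrow> bool" where
  "is_ordering xs S \<longleftrightarrow> distinct xs \<and> set xs = S"

lemma length_is_ordering_nsets:
  "is_ordering xs ([{1..n}]\<^bsup>k\<^esup>) \<Longrightarrow> length xs = n choose k"
  unfolding is_ordering_def by (metis card_atLeastAtMost card_nsets diff_Suc_1 distinct_card)

definition adjacency_mat :: "'a list \<Rightarrow> 'a pair_pre_digraph \<Rightarrow> real mat" where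
  "adjacency_mat vs G =
    mat (length vs) (length vs) (\<lambda>(i, j). if (vs ! i, vs ! j) \<in> parcs G then 1 else 0)"

text \<open>In a symmetric digraph the out-degree of a vertex is its degree as an undirected graph.\<close>

definition degree_mat :: "'a list \<Rightarrow> 'a pair_pre_digraph \<Rightarrow> real mat" where
  "degree_mat vs G =
    mat (length vs) (length vs)
      (\<lambda>(i, j). if i = j then real (out_degree (with_proj G) (vs ! i)) else 0)"

definition laplacian_mat :: "'a list \<Rightarrow> 'a pair_pre_digraph \<Rightarrow> real mat" where
  "laplacian_mat vs G = degree_mat vs G - adjacency_mat vs G"

text \<open>
  The \<open>(n; k\<^sub>2, k\<^sub>1)\<close>-binomial matrix, where \<open>rs\<close> and \<open>cs\<close> enumerate the \<open>k\<^sub>2\<close>-subsets and the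
  \<open>k\<^sub>1\<close>-subsets of \<open>{1..n}\<close>, respectively.
\<close>

definition binomial_mat :: "'a set list \<Rightarrow> 'a set list \<Rightarrow> real mat" where
  "binomial_mat rs cs =
    mat (length rs) (length cs) (\<lambda>(i, j). if cs ! j \<subseteq> rs ! i then 1 else 0)"

end

theory Submission
  imports Defs "HOL-Combinatorics.Transposition"
begin

text \<open>
  Both Laplacians come from one element of the group algebra of the symmetric group: on
  \<open>k\<close>-subsets, \<open>2 L\<^sub>k\<close> is the sum of \<open>I - P\<^sub>a\<^sub>b\<close> over all arcs \<open>(a, b)\<close>, where
  \<open>P\<^sub>a\<^sub>b\<close> permutes the subsets by the transposition of \<open>a\<close> and \<open>b\<close>. Since a permutation
  preserves inclusion, the binomial matrix intertwines the operators \<open>P\<^sub>a\<^sub>b\<close>, hence also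
  the Laplacians.
\<close>

lemma transpose_image_exchange:
  assumes "a \<in> A" "b \<notin> A"
  shows "transpose a b ` A = insert b (A - {a})"
proof -
  have "transpose a b ` (A - {a}) = A - {a}"
    using assms by (force simp: transpose_def image_iff)
  moreover have "A = insert a (A - {a})" using assms by auto
  ultimately show ?thesis by (metis image_insert transpose_apply_first)
qed

text \<open>A transposition is an injective involution, so applying it to both sides moves it across
  the inclusion.\<close>

lemma transpose_image_subset_iff:
  "transpose a b ` X \<subseteq> A \<longleftrightarrow> X \<subseteq> transpose a b ` A"
proof -
  have "transpose a b ` X \<subseteq> A \<longleftrightarrow> transpose a b ` transpose a b ` X \<subseteq> transpose a b ` A"
    by (simp add: inj_image_subset_iff)
  then show ?thesis by (simp add: image_image)
qed

lemma transpose_image_nsets: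
  assumes "A \<in> [V]\<^bsup>k\<^esup>" "a \<in> V" "b \<in> V"
  shows "transpose a b ` A \<in> [V]\<^bsup>k\<^esup>"
proof -
  have "card (transpose a b ` A) = card A"
    by (simp add: card_image)
  moreover have "transpose a b ` A \<subseteq> V"
    using assms by (auto simp: nsets_def transpose_def)
  ultimately show ?thesis using assms by (simp add: nsets_def)
qed

text \<open>With tokens on \<open>A\<close>, these arcs are the legal moves: a token at the tail, a
  free vertex at the head. Only one of the two arcs of an edge can qualify.\<close>

definition crossing_arcs :: "'a pair_pre_digraph \<Rightarrow> 'a set \<Rightarrow> ('a \<times> 'a) set" where
  "crossing_arcs G A = {(a, b) \<in> parcs G. a \<in> A \<and> b \<notin> A}"

text \<open>The move can be recovered from its result: the head is the only new element, the tail
  the only lost one. Hence distinct moves from \<open>A\<close> reach distinct neighbours.\<close>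

lemma inj_on_crossing_arcs:
  "inj_on (\<lambda>(a, b). transpose a b ` A) (crossing_arcs G A)"
proof (rule inj_onI, clarify)
  fix a b c d
  assume arcs: "(a, b) \<in> crossing_arcs G A" "(c, d) \<in> crossing_arcs G A"
    and "transpose a b ` A = transpose c d ` A"
  then have eq: "insert b (A - {a}) = insert d (A - {c})"
    by (simp add: crossing_arcs_def transpose_image_exchange)
  have mem: "a \<in> A" "b \<notin> A" "c \<in> A" "d \<notin> A"
    using arcs by (auto simp: crossing_arcs_def)
  have "b = d" using eq mem by blast
  \<comment> \<open>On the right-hand side of \<open>eq\<close>, \<open>c\<close> has been removed,
    and it differs from \<open>d\<close> because \<open>d\<close> lies outside
    \<open>A\<close>.\<close>
  have "c \<notin> insert b (A - {a})" unfolding eq using mem by blast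
  then have "a = c" using mem by blast
  with \<open>b = d\<close> show "a = c \<and> b = d" by simp
qed

text \<open>Sliding a token from \<open>a\<close> to a free \<open>b\<close> has the same effect on
  \<open>A\<close> as transposing \<open>a\<close> and \<open>b\<close>, since the transposition
  fixes every other element of \<open>A\<close>.\<close>

lemma token_graph_neighbours:
  assumes "pair_graph G" "A \<in> [pverts G]\<^bsup>k\<^esup>"
  shows "{B. (A, B) \<in> parcs (token_graph k G)}
       = (\<lambda>(a, b). transpose a b ` A) ` crossing_arcs G A"
proof (intro equalityI subsetI)
  fix B assume "B \<in> {B. (A, B) \<in> parcs (token_graph k G)}"
  then obtain a b where ab: "sym_diff A B = {a, b}" "a \<in> A" "b \<in> B" "(a, b) \<in> parcs G"
    and B: "B \<in> [pverts G]\<^bsup>k\<^esup>"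
    by (auto simp: token_graph_def)
  have nin: "a \<notin> B" "b \<notin> A" using ab by blast+
  then have "B = insert b (A - {a})" using ab by blast
  then have "B = transpose a b ` A" using nin ab by (simp add: transpose_image_exchange)
  then show "B \<in> (\<lambda>(a, b). transpose a b ` A) ` crossing_arcs G A"
    using ab nin by (force simp: crossing_arcs_def)
next
  interpret pair_graph G by (rule assms)
  fix B assume "B \<in> (\<lambda>(a, b). transpose a b ` A) ` crossing_arcs G A"
  then obtain a b where ab: "(a, b) \<in> parcs G" "a \<in> A" "b \<notin> A" "B = transpose a b ` A"
    by (auto simp: crossing_arcs_def)
  have V: "a \<in> pverts G" "b \<in> pverts G" using ab(1) by (auto dest: in_arcsD1 in_arcsD2)
  have "B = insert b (A - {a})" using ab by (simp add: transpose_image_exchange)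
  then have "sym_diff A B = {a, b}" "b \<in> B" using ab by auto
  moreover have "B \<in> [pverts G]\<^bsup>k\<^esup>" using transpose_image_nsets[OF assms(2) V] ab by simp
  ultimately show "B \<in> {B. (A, B) \<in> parcs (token_graph k G)}"
    using ab assms(2) by (auto simp: token_graph_def)
qed

text \<open>The factor 2 arises because an edge with exactly one end in \<open>A\<close> contributes
  both of its arcs, with equal terms. Every other edge has a transposition that fixes
  \<open>A\<close> as a set and contributes 0.\<close>

lemma sum_crossing_arcs:
  fixes f :: "'a set \<Rightarrow> real"
  assumes "pair_graph G"
  shows "(\<Sum>(a, b)\<in>parcs G. f A - f (transpose a b ` A))
       = 2 * (\<Sum>(a, b)\<in>crossing_arcs G A. f A - f (transpose a b ` A))"
proof -
  interpret pair_graph G by (rule assms)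
  let ?g = "\<lambda>(a, b). f A - f (transpose a b ` A)"
  let ?C = "crossing_arcs G A"
  have sym: "(b, a) \<in> parcs G" if "(a, b) \<in> parcs G" for a b
    using pair_sym_arcs that by (auto simp: symmetric_def sym_def)
  have sub: "?C \<subseteq> parcs G" "prod.swap ` ?C \<subseteq> parcs G"
    using sym by (auto simp: crossing_arcs_def)
  have fin: "finite ?C" "finite (prod.swap ` ?C)"
    by (rule finite_subset[OF _ pair_finite_arcs], rule sub)+
  have zero: "?g e = 0" if "e \<in> parcs G - (?C \<union> prod.swap ` ?C)" for e
  proof -
    obtain a b where e: "e = (a, b)" by (cases e)
    have "a \<in> A \<longleftrightarrow> b \<in> A"
      using that sym[of a b] unfolding e by (force simp: crossing_arcs_def)
    then show ?thesis by (simp add: e)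
  qed
  have "sum ?g (parcs G) = sum ?g (?C \<union> prod.swap ` ?C)"
    using zero sub by (intro sum.mono_neutral_right) auto
  \<comment> \<open>The union is disjoint: arcs in \<open>?C\<close> start inside \<open>A\<close>,
    reversed ones start outside.\<close>
  also have "\<dots> = sum ?g ?C + sum ?g (prod.swap ` ?C)"
    using fin by (intro sum.union_disjoint) (auto simp: crossing_arcs_def)
  also have "sum ?g (prod.swap ` ?C) = sum ?g ?C"
    by (subst sum.reindex) (auto intro!: sum.cong simp: transpose_commute)
  finally show ?thesis by simp
qed

text \<open>The entry is the Laplacian applied to the indicator of the \<open>j\<close>-th subset,
  evaluated at the \<open>i\<close>-th: a sum of differences over neighbours. Neighbours correspond
  to crossing arcs, and extending the sum to all arcs doubles it, whence the division by 2.\<close>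

lemma laplacian_mat_token_graph:
  assumes "pair_graph G" "is_ordering vs ([pverts G]\<^bsup>k\<^esup>)"
    and i: "i < length vs" and j: "j < length vs"
  shows "laplacian_mat vs (token_graph k G) $$ (i, j)
       = (\<Sum>(a, b)\<in>parcs G. of_bool (vs ! j = vs ! i) - of_bool (vs ! j = transpose a b ` (vs ! i))) / 2"
proof -
  interpret T: pair_graph "token_graph k G" by (rule pair_graph_token_graph[OF assms(1)])
  let ?A = "vs ! i"
  let ?N = "{B. (?A, B) \<in> parcs (token_graph k G)}"
  let ?f = "\<lambda>B. of_bool (vs ! j = B) :: real"
  have A: "?A \<in> [pverts G]\<^bsup>k\<^esup>"
    using assms(2) nth_mem[OF i] by (simp add: is_ordering_def)
  have ij: "i = j \<longleftrightarrow> vs ! j = ?A"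
    using assms(2) nth_eq_iff_index_eq[OF _ j i] by (auto simp: is_ordering_def)
  have "out_arcs (with_proj (token_graph k G)) ?A = Pair ?A ` ?N"
    by (auto simp: out_arcs_def)
  then have deg: "out_degree (with_proj (token_graph k G)) ?A = card ?N"
    by (simp add: out_degree_def card_image inj_on_def)
  have "finite (Pair ?A ` ?N)"
    by (rule finite_subset[OF _ T.pair_finite_arcs]) auto
  then have fin: "finite ?N" by (rule finite_imageD) (simp add: inj_on_def)
  have "laplacian_mat vs (token_graph k G) $$ (i, j)
      = real (card ?N) * ?f ?A - of_bool (vs ! j \<in> ?N)"
    using i j ij deg by (auto simp: laplacian_mat_def degree_mat_def adjacency_mat_def)
  \<comment> \<open>The degree term is split into one copy of \<open>?f ?A\<close> per neighbour;
    the adjacency entry is the sum of \<open>?f\<close> over \<open>?N\<close>.\<close>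
  also have "\<dots> = (\<Sum>B\<in>?N. ?f ?A - ?f B)"
    using fin by (simp add: sum_subtractf of_bool_def)
  also have "\<dots> = (\<Sum>(a, b)\<in>crossing_arcs G ?A. ?f ?A - ?f (transpose a b ` ?A))"
    unfolding token_graph_neighbours[OF assms(1) A]
    by (subst sum.reindex[OF inj_on_crossing_arcs]) (simp add: case_prod_unfold)
  also have "\<dots> = (\<Sum>(a, b)\<in>parcs G. ?f ?A - ?f (transpose a b ` ?A)) / 2"
    using sum_crossing_arcs[OF assms(1), of ?f ?A] by simp
  finally show ?thesis .
qed

lemma sum_nth_of_bool_eq:
  fixes g :: "'a \<Rightarrow> real"
  assumes "is_ordering vs S" "X \<in> S"
  shows "(\<Sum>i<length vs. g (vs ! i) * of_bool (vs ! i = X)) = g X"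
proof -
  have "bij_betw (nth vs) {..<length vs} S"
    using assms by (auto simp: is_ordering_def intro: bij_betw_nth)
  then have "(\<Sum>i<length vs. g (vs ! i) * of_bool (vs ! i = X)) = (\<Sum>Y\<in>S. g Y * of_bool (Y = X))"
    by (rule sum.reindex_bij_betw)
  also have "\<dots> = g X"
    using assms by (subst sum.remove[of _ X]) (auto simp: is_ordering_def)
  finally show ?thesis .
qed

text \<open>This evaluates both matrix products: \<open>g\<close> will be a row of the binomial
  matrix in one and a column in the other. After exchanging the sums, each indicator selects one
  value of \<open>g\<close>.\<close>

lemma sum_nth_arc_differences:
  fixes g :: "'a set \<Rightarrow> real"
  assumes "is_ordering vs S" "Y \<in> S" "\<And>a b. (a, b) \<in> E \<Longrightarrow> transpose a b ` Y \<in> S"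
  shows "(\<Sum>i<length vs. g (vs ! i) *
            ((\<Sum>(a, b)\<in>E. of_bool (vs ! i = Y) - of_bool (vs ! i = transpose a b ` Y)) / 2))
       = (\<Sum>(a, b)\<in>E. g Y - g (transpose a b ` Y)) / 2"
proof -
  let ?I = "{..<length vs}"
  have "(\<Sum>i\<in>?I. g (vs ! i) *
            ((\<Sum>(a, b)\<in>E. of_bool (vs ! i = Y) - of_bool (vs ! i = transpose a b ` Y)) / 2))
      = (\<Sum>i\<in>?I. \<Sum>(a, b)\<in>E. g (vs ! i) * of_bool (vs ! i = Y)
            - g (vs ! i) * of_bool (vs ! i = transpose a b ` Y)) / 2"
    unfolding times_divide_eq_right sum_divide_distrib[symmetric] sum_distrib_left
    by (simp only: case_prod_unfold right_diff_distrib)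
  also have "\<dots> = (\<Sum>(a, b)\<in>E. \<Sum>i\<in>?I. g (vs ! i) * of_bool (vs ! i = Y)
            - g (vs ! i) * of_bool (vs ! i = transpose a b ` Y)) / 2"
    by (subst sum.swap) (simp only: case_prod_unfold)
  also have "\<dots> = (\<Sum>(a, b)\<in>E. g Y - g (transpose a b ` Y)) / 2"
  proof (intro arg_cong[of _ _ "\<lambda>x. x / 2"] sum.cong refl, clarify)
    fix a b assume "(a, b) \<in> E"
    then show "(\<Sum>i\<in>?I. g (vs ! i) * of_bool (vs ! i = Y)
          - g (vs ! i) * of_bool (vs ! i = transpose a b ` Y)) = g Y - g (transpose a b ` Y)"
      unfolding sum_subtractf
      by (simp only: sum_nth_of_bool_eq[OF assms(1,2)] sum_nth_of_bool_eq[OF assms(1,3)])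
  qed
  finally show ?thesis .
qed

theorem theorem4p3:
  fixes n k1 k2 :: nat
    and G :: "nat pair_pre_digraph"
    and subsets :: "nat \<Rightarrow> nat set list"
  assumes "pair_graph G" and "pverts G = {1..n}"
    and "1 \<le> k1" and "k1 \<le> k2" and "k2 \<le> n"
    and "is_ordering (subsets k1) ([{1..n}]\<^bsup>k1\<^esup>)"
    and "is_ordering (subsets k2) ([{1..n}]\<^bsup>k2\<^esup>)"
  shows "binomial_mat (subsets k2) (subsets k1) * laplacian_mat (subsets k1) (token_graph k1 G)
       = laplacian_mat (subsets k2) (token_graph k2 G) * binomial_mat (subsets k2) (subsets k1)"
    (is "?B * ?L1 = ?L2 * ?B")
proof (rule eq_matI)
  interpret pair_graph G by (rule assms)
  let ?r = "subsets k2" and ?c = "subsets k1"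
  note ord = assms(6,7)[folded assms(2)]
  have dims: "?B \<in> carrier_mat (length ?r) (length ?c)"
    "?L1 \<in> carrier_mat (length ?c) (length ?c)" "?L2 \<in> carrier_mat (length ?r) (length ?r)"
    by (auto simp: binomial_mat_def laplacian_mat_def degree_mat_def adjacency_mat_def
        intro!: minus_carrier_mat)
  show "dim_row (?B * ?L1) = dim_row (?L2 * ?B)" "dim_col (?B * ?L1) = dim_col (?L2 * ?B)"
    using dims by auto
  fix i j assume "i < dim_row (?L2 * ?B)" "j < dim_col (?L2 * ?B)"
  then have i: "i < length ?r" and j: "j < length ?c" using dims by auto
  let ?A = "?r ! i" and ?X = "?c ! j"
  have A: "?A \<in> [pverts G]\<^bsup>k2\<^esup>" and X: "?X \<in> [pverts G]\<^bsup>k1\<^esup>"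
    using ord nth_mem[OF i] nth_mem[OF j] by (simp_all add: is_ordering_def)
  have A': "transpose a b ` ?A \<in> [pverts G]\<^bsup>k2\<^esup>"
    and X': "transpose a b ` ?X \<in> [pverts G]\<^bsup>k1\<^esup>" if "(a, b) \<in> parcs G" for a b
    using transpose_image_nsets[OF A] transpose_image_nsets[OF X]
      in_arcsD1[OF that] in_arcsD2[OF that] by simp_all
  have flip: "?X = transpose a b ` Y \<longleftrightarrow> Y = transpose a b ` ?X" for a b :: nat and Y
    by (auto simp: image_image)
  have L1: "?L1 $$ (m, j)
      = (\<Sum>(a, b)\<in>parcs G. of_bool (?c ! m = ?X) - of_bool (?c ! m = transpose a b ` ?X)) / 2"
    if "m < length ?c" for m
    by (simp only: laplacian_mat_token_graph[OF assms(1) ord(1) that j]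
        flip[of _ _ "?c ! m"] eq_commute[of ?X "?c ! m"])
  have "(?B * ?L1) $$ (i, j) = (\<Sum>m<length ?c. ?B $$ (i, m) * ?L1 $$ (m, j))"
    using dims i j by (auto simp: scalar_prod_def lessThan_atLeast0)
  also have "\<dots> = (\<Sum>m<length ?c. of_bool (?c ! m \<subseteq> ?A) *
      ((\<Sum>(a, b)\<in>parcs G. of_bool (?c ! m = ?X) - of_bool (?c ! m = transpose a b ` ?X)) / 2))"
    using i j by (intro sum.cong refl) (simp add: L1 binomial_mat_def)
  also have "\<dots> = (\<Sum>(a, b)\<in>parcs G. of_bool (?X \<subseteq> ?A) - of_bool (transpose a b ` ?X \<subseteq> ?A)) / 2"
    using sum_nth_arc_differences[OF ord(1) X X', where g = "\<lambda>Y. of_bool (Y \<subseteq> ?A)"] .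
  \<comment> \<open>The intertwining itself: term by term, the transposition passes from the
    \<open>k1\<close>-subset to the \<open>k2\<close>-subset.\<close>
  also have "\<dots> = (\<Sum>(a, b)\<in>parcs G. of_bool (?X \<subseteq> ?A) - of_bool (?X \<subseteq> transpose a b ` ?A)) / 2"
    by (simp add: transpose_image_subset_iff)
  \<comment> \<open>The evaluation is now read backwards, with \<open>g\<close> the column of
    \<open>?B\<close> at \<open>?X\<close>, to rebuild the other product.\<close>
  also have "\<dots> = (\<Sum>m<length ?r. of_bool (?X \<subseteq> ?r ! m) *
      ((\<Sum>(a, b)\<in>parcs G. of_bool (?r ! m = ?A) - of_bool (?r ! m = transpose a b ` ?A)) / 2))"
    using sum_nth_arc_differences[OF ord(2) A A', where g = "\<lambda>Y. of_bool (?X \<subseteq> Y)", symmetric] .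
  also have "\<dots> = (\<Sum>m<length ?r. ?L2 $$ (i, m) * ?B $$ (m, j))"
    using i j by (intro sum.cong refl)
      (auto simp: laplacian_mat_token_graph[OF assms(1) ord(2)] binomial_mat_def)
  also have "\<dots> = (?L2 * ?B) $$ (i, j)"
    using dims i j by (auto simp: scalar_prod_def lessThan_atLeast0)
  finally show "(?B * ?L1) $$ (i, j) = (?L2 * ?B) $$ (i, j)" .
qed

end
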